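(* Let $\mathbb P$ be a stationary probability measure on $\mathcal N$ with finite intensity, and suppose $\mathbb P$ has finite range of dependence. Then there exists $p_*\in(0,1)$ such that for every $p\in[0,p_*]$, $\mathbb Q$-almost surely the graph $\mathcal G(\xi,W)$ has only bounded connected components.
   Context: $\mathcal N$ = locally finite subsets of $\mathbb R^d$, identified with counting measures ($\xi(A)=\#(\xi\cap A)$), with $\sigma$-algebra generated by $\xi\mapsto\xi(A)$; $\tau_x\xi:=\xi-x$; stationarity means $\mathbb P(\tau_xA)=\mathbb P(A)$ for all $x,A$; the intensity is $\mathbb E[\xi([0,1]^d)]$. $\mathrm{Vor}(x|\xi)=\{y:|y-x|\le|y-z|\ \forall z\in\xi\}$. $\mathcal N_{\rm pol}$ is the set of $\xi\in\mathcal N$ all of whose Voronoi cells are convex polytopes (bounded polyhedra); a stationary $\mathbb P$ satisfies $\mathbb P(\mathcal N_{\rm pol})=1$. $\mathrm{DT}(\xi)$ is the graph on $\xi$ with edge set $\mathcal E_{\rm DT}(\xi)$ consisting of pairs $\{x,y\}$, $x\ne y$, whose Voronoi cells share a $(d-1)$-dimensional face. Finite range of dependence: $\exists L>0$ such that $\xi\cap A$ and $\xi\cap B$ are $\mathbb P$-independent for Borel $A,B$ at distance $\ge L$. Bernoulli bond percolation on $\mathrm{DT}$: for $p\in[0,1]$, $\mathbb Q$ is the probability on $\mathcal X=\{(\xi,W):\xi\in\mathcal N_{\rm pol},W\in\{0,1\}^{\mathcal E_{\rm DT}(\xi)}\}$ under which $\xi$ has law $\mathbb P$ restricted to $\mathcal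 N_{\rm pol}$ and, given $\xi$, the $W_{x,y}$ are i.i.d. Bernoulli($p$). $\mathcal G(\xi,W)$ is the graph with vertex set $\xi$ and edges the $\{x,y\}\in\mathcal E_{\rm DT}(\xi)$ with $W_{x,y}=1$. *)

theory Defs
  imports "HOL-Probability.Probability"
begin

definition Nset :: "'a::euclidean_space set set" where
  "Nset = {xi. \<forall>K. bounded K \<longrightarrow> finite (xi \<inter> K)}"

definition ncount :: "'a set \<Rightarrow> 'a set \<Rightarrow> enat" where
  "ncount xi A = (if finite (xi \<inter> A) then enat (card (xi \<inter> A)) else \<infinity>)"

definition Nspace :: "'a::euclidean_space set measure" where
  "Nspace = sigma Nset {{xi \<in> Nset. ncount xi A = k} | A k. A \<in> sets borel}"

definition shift :: "'a::euclidean_space \<Rightarrow> 'a set \<Rightarrow> 'a set" where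
  "shift x xi = (\<lambda>z. z - x) ` xi"

definition stationary :: "'a::euclidean_space set measure \<Rightarrow> bool" where
  "stationary P \<longleftrightarrow> (\<forall>x. \<forall>A \<in> sets P. emeasure P (shift x ` A) = emeasure P A)"

definition finite_intensity :: "'a::euclidean_space set measure \<Rightarrow> bool" where
  "finite_intensity P \<longleftrightarrow> (\<integral>\<^sup>+ xi. ncount xi (cbox 0 One) \<partial>P) < \<infinity>"

definition restr_events :: "'a::euclidean_space set measure \<Rightarrow> 'a set \<Rightarrow> 'a set set set" where
  "restr_events P A = {(\<lambda>xi. xi \<inter> A) -` S \<inter> space P | S. S \<in> sets Nspace}"

definition finite_range_dependence :: "'a::euclidean_space set measure \<Rightarrow> bool" where
  "finite_range_dependence P \<longleftrightarrow>
     (\<exists>L>0. \<forall>A B. A \<in> sets borel \<longrightarrow> B \<in> sets borel \<longrightarrow>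
        (\<forall>a\<in>A. \<forall>b\<in>B. L \<le> dist a b) \<longrightarrow>
        prob_space.indep_set P (restr_events P A) (restr_events P B))"

definition Vor :: "'a::euclidean_space \<Rightarrow> 'a set \<Rightarrow> 'a set" where
  "Vor x xi = {y. \<forall>z\<in>xi. dist y x \<le> dist y z}"

definition Npol :: "'a::euclidean_space set set" where
  "Npol = {xi \<in> Nset. \<forall>x\<in>xi. polytope (Vor x xi)}"

definition DT_edges :: "'a::euclidean_space set \<Rightarrow> 'a set set" where
  "DT_edges xi = {{x, y} | x y. x \<in> xi \<and> y \<in> xi \<and> x \<noteq> y \<and>
     (\<exists>F. F face_of Vor x xi \<and> F face_of Vor y xi \<and> aff_dim F = int DIM('a) - 1)}"

definition open_edge :: "'a::euclidean_space set \<Rightarrow> ('a set \<Rightarrow> bool) \<Rightarrow> 'a \<Rightarrow> 'a \<Rightarrow> bool" where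
  "open_edge xi W x y \<longleftrightarrow> {x, y} \<in> DT_edges xi \<and> W {x, y}"

definition cluster :: "'a::euclidean_space set \<Rightarrow> ('a set \<Rightarrow> bool) \<Rightarrow> 'a \<Rightarrow> 'a set" where
  "cluster xi W x = {y. (open_edge xi W)\<^sup>*\<^sup>* x y}"

definition all_clusters_bounded :: "'a::euclidean_space set \<Rightarrow> ('a set \<Rightarrow> bool) \<Rightarrow> bool" where
  "all_clusters_bounded xi W \<longleftrightarrow> (\<forall>x\<in>xi. bounded (cluster xi W x))"

text \<open>Bernoulli(p) bond configurations on the Delaunay edges of xi (conditional law of W given xi).\<close>
definition bond_law :: "real \<Rightarrow> 'a::euclidean_space set \<Rightarrow> ('a set \<Rightarrow> bool) measure" where
  "bond_law p xi = PiM (DT_edges xi) (\<lambda>_. measure_pmf (bernoulli_pmf p))"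

end

theory Submission
  imports Defs
begin

text \<open>
  A Peierls argument after coarse graining. Take a lattice of mesh r and call a site bad if some ball
  of radius r d centred near it is void, if more than M points lie near it, or if some open edge lies
  near it. If a Voronoi cell meets the box of a site whose neighbourhood has no void, the cell is
  small, so that all edges at its nucleus stay near the site. The cells along an open path form a
  connected set, hence an unbounded cluster yields, for every n, a chain of n + 1 bad sites, pairwise
  far apart, with bounded steps. Given the configuration, a site without voids and crowding acquires
  an open edge with probability at most M^2 p, independently over distant sites; by the finite range
  of dependence a given chain is bad with probability at most (q + M^2 p)^(n + 1), where q bounds the
  probability of a void or crowded neighbourhood. This beats the exponential number of chains once
  r, then M, are large and then p is small.
\<close>

section \<open>Lattice paths\<close>

definition int_lattice :: "'a::euclidean_space set" where
  "int_lattice = {z. \<forall>b\<in>Basis. z \<bullet> b \<in> \<int>}"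

text \<open>Coordinatewise floor: \<open>r *\<^sub>R lround r y\<close> is the lower corner of the
  half-open cube of side \<open>r\<close> that contains \<open>y\<close>. The box of a site consists
  of the points that round to it.\<close>

definition lround :: "real \<Rightarrow> 'a::euclidean_space \<Rightarrow> 'a" where
  "lround r y = (\<Sum>b\<in>Basis. of_int \<lfloor>(y \<bullet> b) / r\<rfloor> *\<^sub>R b)"

lemma int_lattice_diff: "z \<in> int_lattice \<Longrightarrow> w \<in> int_lattice \<Longrightarrow> z - w \<in> int_lattice"
  by (auto simp: int_lattice_def inner_simps)

lemma lround_in_int_lattice: "lround r y \<in> int_lattice"
  by (auto simp: int_lattice_def lround_def)

text \<open>Each coordinate moves by at most \<open>r\<close>, and the l1 norm dominates the
  Euclidean one. The resulting length h = \<open>r * DIM('a)\<close> is the unit of all later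
  distances.\<close>

lemma dist_lround:
  fixes y :: "'a::euclidean_space"
  assumes "r > 0"
  shows "dist y (r *\<^sub>R lround r y) \<le> r * DIM('a)"
proof -
  have "\<bar>(y - r *\<^sub>R lround r y) \<bullet> b\<bar> \<le> r" if "b \<in> Basis" for b
  proof -
    have "(y - r *\<^sub>R lround r y) \<bullet> b = r * ((y \<bullet> b) / r - of_int \<lfloor>(y \<bullet> b) / r\<rfloor>)"
      using that assms by (simp add: lround_def inner_simps field_simps)
    moreover have "\<bar>(y \<bullet> b) / r - of_int \<lfloor>(y \<bullet> b) / r\<rfloor>\<bar> \<le> 1"
      by linarith
    ultimately show ?thesis
      using assms by (simp add: abs_mult)
  qed
  then have "(\<Sum>b\<in>Basis. \<bar>(y - r *\<^sub>R lround r y) \<bullet> b\<bar>) \<le> of_nat DIM('a) * r"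
    by (intro sum_bounded_above) auto
  then show ?thesis
    using norm_le_l1[of "y - r *\<^sub>R lround r y"] by (simp add: dist_norm mult.commute)
qed

lemma finite_int_lattice_cball: "finite (int_lattice \<inter> cball (0::'a::euclidean_space) t)"
proof -
  let ?J = "real_of_int ` {-\<lceil>t\<rceil>..\<lceil>t\<rceil>}"
  have "int_lattice \<inter> cball (0::'a) t \<subseteq> (\<lambda>f. \<Sum>b\<in>Basis. f b *\<^sub>R b) ` (PiE Basis (\<lambda>_. ?J))"
  proof
    fix z :: 'a assume z: "z \<in> int_lattice \<inter> cball 0 t"
    have "z \<bullet> b \<in> ?J" if b: "b \<in> Basis" for b
    proof -
      obtain k where k: "z \<bullet> b = of_int k"
        using z b by (auto simp: int_lattice_def elim: Ints_cases)
      have "\<bar>z \<bullet> b\<bar> \<le> t"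
        using z Basis_le_norm[OF b, of z] by (simp)
      then have "k \<in> {-\<lceil>t\<rceil>..\<lceil>t\<rceil>}"
        unfolding k atLeastAtMost_iff by linarith
      then show ?thesis
        using k by auto
    qed
    then have "restrict (\<lambda>b. z \<bullet> b) Basis \<in> PiE Basis (\<lambda>_. ?J)"
      by auto
    moreover have "z = (\<Sum>b\<in>Basis. restrict (\<lambda>b. z \<bullet> b) Basis b *\<^sub>R b)"
      by (simp add: euclidean_representation)
    ultimately show "z \<in> (\<lambda>f. \<Sum>b\<in>Basis. f b *\<^sub>R b) ` (PiE Basis (\<lambda>_. ?J))"
      by blast
  qed
  then show ?thesis
    by (rule finite_subset) (intro finite_imageI finite_PiE; simp)
qed

lemma countable_int_lattice: "countable (int_lattice :: 'a::euclidean_space set)"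
proof -
  have "(int_lattice :: 'a set) = (\<Union>n. int_lattice \<inter> cball 0 (real n))"
  proof (intro set_eqI iffI)
    fix z :: 'a assume "z \<in> int_lattice"
    moreover obtain n where "norm z \<le> real n"
      using real_arch_simple by blast
    ultimately show "z \<in> (\<Union>n. int_lattice \<inter> cball 0 (real n))"
      by auto
  qed auto
  moreover have "countable \<dots>"
    by (rule countable_UN) (simp_all add: countable_finite[OF finite_int_lattice_cball])
  ultimately show ?thesis by simp
qed

text \<open>Chains of n + 1 sites, in lattice coordinates. The increments come from one finite set,
  which makes counting easy; each site is kept at distance \<open>s\<close> from all later ones and
  not only from the next, which gives pairwise separation.\<close>

primrec sep_paths :: "real \<Rightarrow> real \<Rightarrow> nat \<Rightarrow> 'a::euclidean_space \<Rightarrow> 'a list set" where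
  "sep_paths s t 0 z = {[z]}"
| "sep_paths s t (Suc n) z = (\<Union>u\<in>int_lattice \<inter> cball 0 t.
     (#) z ` {\<gamma> \<in> sep_paths s t n (z + u). \<forall>w\<in>set \<gamma>. s \<le> dist z w})"

lemma finite_sep_paths: "finite (sep_paths s t n z)"
  by (induction n arbitrary: z) (auto simp: finite_int_lattice_cball)

text \<open>The entropy factor of the Peierls argument: n increments are chosen from a fixed finite
  set, and dropping the separation condition only enlarges the count.\<close>

lemma card_sep_paths:
  "card (sep_paths s t n (z::'a::euclidean_space)) \<le> card (int_lattice \<inter> cball (0::'a) t) ^ n"
proof (induction n arbitrary: z)
  case (Suc n)
  have "card (sep_paths s t (Suc n) z) \<le> (\<Sum>u\<in>int_lattice \<inter> cball 0 t.
     card ((#) z ` {\<gamma> \<in> sep_paths s t n (z + u). \<forall>w\<in>set \<gamma>. s \<le> dist z w}))"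
    unfolding sep_paths.simps by (rule card_UN_le) (rule finite_int_lattice_cball)
  also have "\<dots> \<le> (\<Sum>u\<in>int_lattice \<inter> cball (0::'a) t. card (int_lattice \<inter> cball (0::'a) t) ^ n)"
  proof (rule sum_mono)
    fix u
    have "card ((#) z ` {\<gamma> \<in> sep_paths s t n (z + u). \<forall>w\<in>set \<gamma>. s \<le> dist z w})
      \<le> card {\<gamma> \<in> sep_paths s t n (z + u). \<forall>w\<in>set \<gamma>. s \<le> dist z w}"
      by (rule card_image_le) (auto simp: finite_sep_paths)
    also have "\<dots> \<le> card (sep_paths s t n (z + u))"
      by (rule card_mono) (auto simp: finite_sep_paths)
    finally show "card ((#) z ` {\<gamma> \<in> sep_paths s t n (z + u). \<forall>w\<in>set \<gamma>. s \<le> dist z w})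
      \<le> card (int_lattice \<inter> cball (0::'a) t) ^ n"
      using Suc.IH order_trans by blast
  qed
  finally show ?case by simp
qed simp

lemma sep_paths_pairwise:
  assumes "\<gamma> \<in> sep_paths s t n z"
  shows "pairwise (\<lambda>v w. s \<le> dist v w) (set \<gamma>)"
  using assms
  by (induction n arbitrary: z \<gamma>) (fastforce simp: pairwise_insert dist_commute)+

text \<open>Positive separation makes the sites distinct, so a product over
  \<open>set \<gamma>\<close> has a full n + 1 factors.\<close>

lemma sep_paths_card_set:
  assumes "\<gamma> \<in> sep_paths s t n z" "0 < s"
  shows "card (set \<gamma>) = Suc n"
  using assms
proof (induction n arbitrary: z \<gamma>)
  case (Suc n)
  then obtain u \<gamma>' where *: "\<gamma>' \<in> sep_paths s t n (z + u)" "\<forall>w\<in>set \<gamma>'. s \<le> dist z w" "\<gamma> = z # \<gamma>'"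
    by auto
  then have "z \<notin> set \<gamma>'"
    using \<open>0 < s\<close> by force
  then show ?case
    using Suc.IH[OF *(1)] \<open>0 < s\<close> by (simp add: *)
qed auto

text \<open>At each step the path is cut at its last exit from a ball around the current point, so that
  everything that follows stays away from that point.\<close>
lemma path_sep_paths:
  fixes g :: "real \<Rightarrow> 'a::euclidean_space" and r :: real
  assumes r: "r > 0" and "path g"
    and "real n * (21 * (r * DIM('a))) \<le> dist (pathstart g) (pathfinish g)"
  shows "\<exists>\<gamma> \<in> sep_paths (19 * real DIM('a)) (23 * real DIM('a)) n (lround r (pathstart g)).
    set \<gamma> \<subseteq> lround r ` path_image g"
  using assms(2,3)
proof (induction n arbitrary: g)
  case 0
  then show ?case
    by (auto intro!: imageI)
next
  case (Suc n)
  \<comment> \<open>21 = 19 + 2 = 23 - 2: rounding two points changes their distance by at most 2h,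
    so points at distance R round to sites between 19 and 23 times the dimension apart.\<close>
  define R :: real where "R = 21 * (r * DIM('a))"
  define f where "f t = dist (g 0) (g t)" for t
  have R: "R > 0" using r by (simp add: R_def)
  have f: "continuous_on {0..1} f"
    unfolding f_def using \<open>path g\<close> by (auto simp: path_def intro!: continuous_intros)
  have f1: "real (Suc n) * R \<le> f 1"
    using Suc.prems by (simp add: f_def R_def pathstart_def pathfinish_def)
  then have f1R: "R \<le> f 1"
    using R by (simp add: distrib_right) (smt (verit) mult_nonneg_nonneg of_nat_0_le_iff)
  define T where "T = {t \<in> {0..1}. f t = R}"
  have "closed T"
    unfolding T_def by (rule continuous_closed_preimage_constant[OF f]) auto
  moreover have "bounded T"
    by (rule bounded_subset[of "{0..1}"]) (auto simp: T_def)
  ultimately have "compact T"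
    by (simp add: compact_eq_bounded_closed)
  moreover have "T \<noteq> {}"
    using IVT'[of f 0 R 1] f1R f R by (auto simp: T_def f_def)
  ultimately obtain t0 where t0: "t0 \<in> T" "\<And>t. t \<in> T \<Longrightarrow> t \<le> t0"
    using compact_attains_sup[of T] by auto
  then have t01: "t0 \<in> {0..1}" "f t0 = R" by (auto simp: T_def)
  \<comment> \<open>A later time with \<open>f t < R\<close> would, since \<open>f 1\<close> is at
    least R, be followed by another crossing of the level R, against the maximality of
    \<open>t0\<close>.\<close>
  have far: "R \<le> f t" if t: "t \<in> {t0..1}" for t
  proof (rule ccontr)
    assume "\<not> R \<le> f t"
    then obtain t' where t': "t \<le> t'" "t' \<le> 1" "f t' = R"
      using IVT'[of f t R 1] f1R t t01 continuous_on_subset[OF f, of "{t..1}"] by auto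
    then have "t' \<in> T"
      using t t01 by (auto simp: T_def)
    then have "t' \<le> t0" using t0 by blast
    with t' t have "t = t'" by auto
    with t' \<open>\<not> R \<le> f t\<close> show False by simp
  qed
  let ?g = "subpath t0 1 g"
  have g: "path ?g" "pathstart ?g = g t0" "pathfinish ?g = g 1"
    using path_subpath[OF Suc.prems(1)] t01 by auto
  have im: "path_image ?g = g ` {t0..1}"
    using t01 by (simp add: path_image_subpath)
  \<comment> \<open>The part of the path that is cut off uses up only R of the distance (n + 1) R,
    so the rest qualifies for the induction hypothesis.\<close>
  have "f 1 \<le> f t0 + dist (g t0) (g 1)"
    unfolding f_def by (rule dist_triangle)
  then have "real n * R \<le> dist (g t0) (g 1)"
    using f1 t01 by (simp add: distrib_right)
  then obtain \<gamma> where \<gamma>: "\<gamma> \<in> sep_paths (19 * real DIM('a)) (23 * real DIM('a)) n (lround r (g t0))"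
      "set \<gamma> \<subseteq> lround r ` path_image ?g"
    using Suc.IH[OF g(1)] by (auto simp: g R_def)
  define z where "z = lround r (g 0)"
  define u where "u = lround r (g t0) - z"
  have zd: "dist (g 0) (r *\<^sub>R z) \<le> r * DIM('a)"
    unfolding z_def using r by (rule dist_lround)
  have up: "r * dist z (lround r y) \<le> dist (g 0) y + 2 * (r * DIM('a))"
    and low: "dist (g 0) y \<le> r * dist z (lround r y) + 2 * (r * DIM('a))" for y
  proof -
    have "dist (r *\<^sub>R z) (r *\<^sub>R lround r y) = r * dist z (lround r y)"
      using r by (simp add: dist_norm flip: scaleR_diff_right)
    then show "r * dist z (lround r y) \<le> dist (g 0) y + 2 * (r * DIM('a))"
      "dist (g 0) y \<le> r * dist z (lround r y) + 2 * (r * DIM('a))"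
      using zd dist_lround[OF r, of y]
        dist_triangle[of "r *\<^sub>R z" "r *\<^sub>R lround r y" "g 0"]
        dist_triangle[of "g 0" "r *\<^sub>R lround r y" y]
        dist_triangle[of "g 0" y "r *\<^sub>R z"]
        dist_triangle[of "r *\<^sub>R z" y "r *\<^sub>R lround r y"]
      unfolding dist_commute[of "r *\<^sub>R lround r y" y] dist_commute[of "r *\<^sub>R z" "g 0"]
      by linarith+
  qed
  have "r * dist z (lround r (g t0)) \<le> r * (23 * real DIM('a))"
    using up[of "g t0"] t01 by (simp add: f_def R_def)
  then have "dist z (lround r (g t0)) \<le> 23 * real DIM('a)"
    using r by simp
  then have "u \<in> int_lattice \<inter> cball 0 (23 * real DIM('a))"
    by (auto simp: u_def z_def int_lattice_diff lround_in_int_lattice dist_norm norm_minus_commute)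
  moreover have "19 * real DIM('a) \<le> dist z w" if w: "w \<in> set \<gamma>" for w
  proof -
    obtain t where t: "t \<in> {t0..1}" "w = lround r (g t)"
      using w \<gamma>(2) im by auto
    have "r * (19 * real DIM('a)) \<le> r * dist z w"
      using low[of "g t"] far[OF t(1)] by (simp add: f_def R_def t)
    then show ?thesis
      using r by simp
  qed
  moreover have "z + u = lround r (g t0)" by (simp add: u_def)
  ultimately have "z # \<gamma> \<in> sep_paths (19 * real DIM('a)) (23 * real DIM('a)) (Suc n) z"
    using \<gamma>(1) unfolding sep_paths.simps by (intro UN_I[of u] imageI) auto
  moreover have "set (z # \<gamma>) \<subseteq> lround r ` path_image g"
    using \<gamma>(2) t01 unfolding im by (auto simp: z_def path_image_def)
  ultimately show ?case
    by (auto simp: z_def pathstart_def)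
qed

section \<open>Voronoi cells near good sites\<close>

text \<open>The part of badness that depends on the points alone; open edges enter through
  \<open>near_edges\<close>. The constants come from \<open>edge_near\<close>: voids must be
  excluded around all points within 6h of the site, where rounding costs another h, and edges can
  reach as far as 9h.\<close>

definition bad_conf :: "real \<Rightarrow> nat \<Rightarrow> 'a::euclidean_space \<Rightarrow> 'a set set" where
  "bad_conf r M z = {xi \<in> Nset.
     (\<exists>u \<in> int_lattice \<inter> cball 0 (7 * real DIM('a)).
        ncount xi (cball (r *\<^sub>R (z + u)) (r * DIM('a))) = 0) \<or>
     enat M < ncount xi (cball (r *\<^sub>R z) (9 * (r * DIM('a))))}"

definition near_edges :: "real \<Rightarrow> 'a::euclidean_space set \<Rightarrow> 'a \<Rightarrow> 'a set set" where
  "near_edges r xi z = {e \<in> DT_edges xi. e \<subseteq> cball (r *\<^sub>R z) (9 * (r * DIM('a)))}"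

lemma ncount_eq_0_iff: "ncount xi A = 0 \<longleftrightarrow> xi \<inter> A = {}"
  by (auto simp: ncount_def zero_enat_def)

text \<open>An edge is the image of an ordered pair of points in the ball, and without crowding
  there are at most M points in it.\<close>

lemma finite_near_edges:
  fixes z :: "'a::euclidean_space"
  assumes "xi \<in> Nset"
  shows "finite (near_edges r xi z)"
    and "xi \<notin> bad_conf r M z \<Longrightarrow> card (near_edges r xi z) \<le> M\<^sup>2"
proof -
  let ?S = "xi \<inter> cball (r *\<^sub>R z) (9 * (r * DIM('a)))"
  have S: "finite ?S"
    using assms by (auto simp: Nset_def)
  have sub: "near_edges r xi z \<subseteq> (\<lambda>(x, y). {x, y}) ` (?S \<times> ?S)"
    by (force simp: near_edges_def DT_edges_def)
  then show "finite (near_edges r xi z)"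
    using S by (meson finite_SigmaI finite_imageI finite_subset)
  assume "xi \<notin> bad_conf r M z"
  then have "card ?S \<le> M"
    using assms S by (auto simp: bad_conf_def ncount_def)
  have "card (near_edges r xi z) \<le> card (?S \<times> ?S)"
    using S by (intro order_trans[OF card_mono[OF _ sub] card_image_le]) auto
  also have "\<dots> \<le> M\<^sup>2"
    unfolding card_cartesian_product power2_eq_square
    using \<open>card ?S \<le> M\<close> by (intro mult_mono) auto
  finally show "card (near_edges r xi z) \<le> M\<^sup>2" .
qed

text \<open>A common edge would have an endpoint within 9h of both centres, but these are 19h apart.
  Disjointness makes the bonds near distant sites independent.\<close>

lemma near_edges_disjoint:
  fixes z w :: "'a::euclidean_space"
  assumes r: "r > 0" and sep: "19 * real DIM('a) \<le> dist z w"
  shows "near_edges r xi z \<inter> near_edges r xi w = {}"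
proof (rule ccontr)
  assume "near_edges r xi z \<inter> near_edges r xi w \<noteq> {}"
  then obtain x where x: "dist (r *\<^sub>R z) x \<le> 9 * (r * DIM('a))" "dist (r *\<^sub>R w) x \<le> 9 * (r * DIM('a))"
    by (fastforce simp: near_edges_def DT_edges_def)
  have "dist (r *\<^sub>R z) (r *\<^sub>R w) = r * dist z w"
    using r by (simp add: dist_norm flip: scaleR_diff_right)
  also have "\<dots> \<ge> r * (19 * real DIM('a))"
    using sep r by simp
  finally have "19 * (r * DIM('a)) \<le> dist (r *\<^sub>R z) (r *\<^sub>R w)" by simp
  moreover have "dist (r *\<^sub>R z) (r *\<^sub>R w) \<le> dist (r *\<^sub>R z) x + dist (r *\<^sub>R w) x"
    by (rule dist_triangle2)
  moreover have "0 < r * DIM('a)" using r by simp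
  ultimately show False using x by linarith
qed

lemma mem_Vor_self: "x \<in> Vor x xi"
  by (simp add: Vor_def)

text \<open>The shared face is nonempty, since the empty set has affine dimension -1 while d - 1 is
  at least 0.\<close>

lemma DT_edge_cells_meet:
  fixes xi :: "'a::euclidean_space set"
  assumes "{x, y} \<in> DT_edges xi"
  shows "x \<in> xi" "y \<in> xi" "Vor x xi \<inter> Vor y xi \<noteq> {}"
proof -
  obtain F where F: "x \<in> xi" "y \<in> xi" "F face_of Vor x xi" "F face_of Vor y xi"
      "aff_dim F = int DIM('a) - 1"
    using assms by (auto simp: DT_edges_def doubleton_eq_iff)
  then have "F \<noteq> {}"
    using DIM_positive[where 'a='a] by force
  with F show "x \<in> xi" "y \<in> xi" "Vor x xi \<inter> Vor y xi \<noteq> {}"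
    using face_of_imp_subset by blast+
qed

text \<open>If the cell of an endpoint meets the box of a good site, then the cell is small, since every
  point v of it is the centre of a ball, with the nucleus on its boundary, whose interior contains
  no point of the configuration.\<close>
lemma edge_near:
  fixes xi :: "'a::euclidean_space set"
  assumes r: "r > 0" and xi: "xi \<in> Npol" and good: "xi \<notin> bad_conf r M (lround r y)"
    and y: "y \<in> Vor x xi" and e: "{x, x'} \<in> DT_edges xi"
  shows "{x, x'} \<in> near_edges r xi (lround r y)"
proof -
  define h where "h = r * DIM('a)"
  define z where "z = lround r y"
  have h: "h > 0" using r by (simp add: h_def)
  \<comment> \<open>The site to which \<open>v\<close> rounds differs from \<open>z\<close> by at
    most 7 times the dimension, so the ball of radius h around it is not void; its centre is within
    h of \<open>v\<close>.\<close>
  have near: "\<exists>w\<in>xi. dist w v \<le> 2 * h" if v: "dist (r *\<^sub>R z) v \<le> 6 * h" for v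
  proof -
    define u where "u = lround r v - z"
    have rd: "dist v (r *\<^sub>R (z + u)) \<le> h"
      using dist_lround[OF r, of v] by (simp add: u_def h_def)
    have "dist (r *\<^sub>R z) (r *\<^sub>R (z + u)) \<le> 7 * h"
      using v rd dist_triangle[of "r *\<^sub>R z" "r *\<^sub>R (z + u)" v] by linarith
    then have "r * norm u \<le> r * (7 * DIM('a))"
      using r by (simp add: dist_norm scaleR_add_right h_def)
    then have "norm u \<le> 7 * real DIM('a)"
      using r by simp
    then have "u \<in> int_lattice \<inter> cball 0 (7 * real DIM('a))"
      by (simp add: u_def z_def int_lattice_diff lround_in_int_lattice)
    then have "ncount xi (cball (r *\<^sub>R (z + u)) h) \<noteq> 0"
      using good xi unfolding bad_conf_def h_def z_def Npol_def by blast
    then obtain w where w: "w \<in> xi" "dist (r *\<^sub>R (z + u)) w \<le> h"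
      by (auto simp: ncount_eq_0_iff)
    have "dist w v \<le> 2 * h"
      using w(2) rd dist_triangle[of v w "r *\<^sub>R (z + u)"] by (simp add: dist_commute)
    with w show ?thesis by blast
  qed
  have yz: "dist (r *\<^sub>R z) y \<le> h"
    using dist_lround[OF r, of y] by (simp add: z_def h_def dist_commute)
  obtain w where w: "w \<in> xi" "dist w y \<le> 2 * h"
    using near[of y] yz h by auto
  have "dist y x \<le> 2 * h"
    using y w by (force simp: Vor_def dist_commute)
  then have xz: "dist (r *\<^sub>R z) x \<le> 3 * h"
    using yz dist_triangle[of "r *\<^sub>R z" x y] by linarith
  have F: "x \<in> xi" "x' \<in> xi"
    using DT_edge_cells_meet[OF e] by auto
  obtain v where v: "v \<in> Vor x xi" "v \<in> Vor x' xi"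
    using DT_edge_cells_meet[OF e] by auto
  have "convex (Vor x xi)"
    using xi F by (auto simp: Npol_def intro: polytope_imp_convex)
  \<comment> \<open>Otherwise convexity puts into the cell a point \<open>v'\<close> of the segment
    at distance exactly 3h from \<open>x\<close>. It lies within 6h of the site, so some
    configuration point is within 2h of it and thus closer to it than \<open>x\<close>.\<close>
  have "dist x v < 3 * h"
  proof (rule ccontr)
    assume far: "\<not> dist x v < 3 * h"
    then have pos: "dist x v > 0" using h by linarith
    define c where "c = 3 * h / dist x v"
    define v' where "v' = (1 - c) *\<^sub>R x + c *\<^sub>R v"
    have c: "0 \<le> c" "c \<le> 1"
      using h far pos by (auto simp: c_def)
    then have v': "v' \<in> Vor x xi"
      unfolding v'_def using \<open>convex (Vor x xi)\<close> mem_Vor_self v by (intro convexD_alt) auto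
    have "v' - x = c *\<^sub>R (v - x)"
      by (simp add: v'_def algebra_simps)
    then have d: "dist v' x = 3 * h"
      using c pos h by (simp add: dist_norm c_def norm_minus_commute)
    then have "dist (r *\<^sub>R z) v' \<le> 6 * h"
      using xz dist_triangle[of "r *\<^sub>R z" v' x] by (simp add: dist_commute)
    then obtain w where "w \<in> xi" "dist w v' \<le> 2 * h"
      using near by blast
    with v' d h show False
      by (force simp: Vor_def dist_commute)
  qed
  \<comment> \<open>The common point \<open>v\<close> also lies in the cell of \<open>x'\<close>, so
    the edge has length at most 6h; with 3h for \<open>x\<close> this gives the radius 9h.\<close>
  moreover have "dist v x' \<le> dist v x"
    using v F by (auto simp: Vor_def)
  ultimately have "dist x x' \<le> 6 * h"
    using dist_triangle[of x x' v] by (simp add: dist_commute)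
  then have "dist (r *\<^sub>R z) x' \<le> 9 * h"
    using xz dist_triangle[of "r *\<^sub>R z" x' x] by linarith
  then show ?thesis
    using xz h e by (simp add: near_edges_def z_def h_def)
qed

section \<open>From an unbounded cluster to a chain of bad sites\<close>

definition open_cells :: "'a::euclidean_space set \<Rightarrow> ('a set \<Rightarrow> bool) \<Rightarrow> 'a set" where
  "open_cells xi W = (\<Union>x\<in>{x. \<exists>y. open_edge xi W x y}. Vor x xi)"

text \<open>Cells are convex and those of adjacent nuclei meet, so paths inside cells can be joined
  at common points. The edge from \<open>x\<close> to \<open>x'\<close> ensures that
  \<open>x\<close> itself lies in \<open>open_cells\<close>, even for the trivial path.\<close>

lemma path_component_open_cells:
  assumes xi: "xi \<in> Npol" and "(open_edge xi W)\<^sup>*\<^sup>* x y" and "open_edge xi W x x'"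
  shows "path_component (open_cells xi W) x y"
  using assms(2)
proof (induction rule: rtranclp_induct)
  case base
  show ?case
    using assms(3) mem_Vor_self by (force simp: open_cells_def intro: path_component_refl)
next
  case (step y z)
  have cell: "path_component (open_cells xi W) u v"
    if "open_edge xi W a b" "u \<in> Vor a xi" "v \<in> Vor a xi" for a b u v
  proof -
    have "a \<in> xi"
      using that DT_edge_cells_meet by (auto simp: open_edge_def)
    then have "path_connected (Vor a xi)"
      using xi by (auto simp: Npol_def intro: convex_imp_path_connected polytope_imp_convex)
    then have "path_component (Vor a xi) u v"
      using that by (simp add: path_connected_component)
    moreover have "Vor a xi \<subseteq> open_cells xi W"
      using that by (auto simp: open_cells_def)
    ultimately show ?thesis
      using path_component_of_subset by blast
  qed
  obtain v where "v \<in> Vor y xi" "v \<in> Vor z xi"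
    using DT_edge_cells_meet step.hyps(2) unfolding open_edge_def by blast
  moreover have "open_edge xi W z y"
    using step.hyps(2) by (simp add: open_edge_def insert_commute)
  ultimately have "path_component (open_cells xi W) y z"
    using cell[OF step.hyps(2) mem_Vor_self, of v] cell[of z y v z] mem_Vor_self
    by (blast intro: path_component_trans)
  with step.IH show ?case
    by (rule path_component_trans)
qed

text \<open>The deterministic part of the argument. A path inside \<open>open_cells\<close> to a far
  point of the cluster yields the chain. Since \<open>open_cells\<close> leaves out isolated nuclei,
  each site of the chain is the rounding of a point in the cell of an endpoint of an open edge;
  unless the site is bad, \<open>edge_near\<close> puts that edge near it.\<close>

lemma unbounded_cluster_sep_path:
  fixes xi :: "'a::euclidean_space set"
  assumes r: "r > 0" and xi: "xi \<in> Npol" and unb: "\<not> bounded (cluster xi W x)"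
  shows "\<exists>\<gamma> \<in> sep_paths (19 * real DIM('a)) (23 * real DIM('a)) n (lround r x).
    \<forall>z\<in>set \<gamma>. xi \<in> bad_conf r M z \<or> (\<exists>e\<in>near_edges r xi z. W e)"
proof -
  obtain y where y: "y \<in> cluster xi W x" "real n * (21 * (r * DIM('a))) \<le> dist x y"
    using unb unfolding bounded_def by (meson linear)
  obtain y' where "y' \<in> cluster xi W x" "y' \<noteq> x"
    using unb by (metis bounded_insert bounded_empty bounded_subset insertCI subsetI)
  then obtain x' where x': "open_edge xi W x x'"
    by (auto simp: cluster_def elim: converse_rtranclpE)
  have "path_component (open_cells xi W) x y"
    using path_component_open_cells[OF xi _ x'] y by (simp add: cluster_def)
  then obtain g where g: "path g" "path_image g \<subseteq> open_cells xi W" "pathstart g = x" "pathfinish g = y"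
    by (auto simp: path_component_def)
  then obtain \<gamma> where \<gamma>: "\<gamma> \<in> sep_paths (19 * real DIM('a)) (23 * real DIM('a)) n (lround r x)"
      "set \<gamma> \<subseteq> lround r ` path_image g"
    using path_sep_paths[OF r g(1), of n] y by auto
  have "xi \<in> bad_conf r M z \<or> (\<exists>e\<in>near_edges r xi z. W e)" if z: "z \<in> set \<gamma>" for z
  proof -
    obtain v where v: "v \<in> open_cells xi W" "z = lround r v"
      using z \<gamma> g by blast
    then obtain a b where ab: "open_edge xi W a b" "v \<in> Vor a xi"
      by (auto simp: open_cells_def)
    then have "xi \<in> bad_conf r M z \<or> {a, b} \<in> near_edges r xi z"
      using edge_near[OF r xi] v(2) by (auto simp: open_edge_def)
    then show ?thesis
      using ab by (auto simp: open_edge_def)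
  qed
  with \<gamma> show ?thesis by blast
qed

section \<open>Bond configurations\<close>

lemma emeasure_bond_law_all_open:
  assumes "S \<subseteq> DT_edges xi" "finite S" "0 \<le> p" "p \<le> 1"
  shows "emeasure (bond_law p xi) {W \<in> space (bond_law p xi). \<forall>e\<in>S. W e} = ennreal p ^ card S"
proof -
  interpret product_prob_space "\<lambda>_::'a set. measure_pmf (bernoulli_pmf p)" "DT_edges xi"
    by unfold_locales
  show ?thesis
    using emeasure_PiM_Collect[of S "\<lambda>_. {True}"] assms
    by (simp add: bond_law_def emeasure_pmf_single)
qed

lemma sets_bond_law_open:
  assumes "e \<in> DT_edges xi"
  shows "{W \<in> space (bond_law p xi). W e} \<in> sets (bond_law p xi)"
proof -
  have [measurable]: "(\<lambda>W. W e) \<in> measurable (bond_law p xi) (count_space UNIV)"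
    unfolding bond_law_def
    using measurable_component_singleton[OF assms, of "\<lambda>_. measure_pmf (bernoulli_pmf p)"] by simp
  show ?thesis by measurable
qed

text \<open>Union bound over the functions that choose one edge for each site. Disjointness makes
  every choice injective, so all chosen edges are open with probability p to the power
  \<open>card Z\<close>, and the number of choices is the product of the cardinalities.\<close>

lemma emeasure_bond_law_each_some_open:
  assumes Z: "finite Z" and E: "\<And>z. z \<in> Z \<Longrightarrow> finite (E z) \<and> E z \<subseteq> DT_edges xi"
    and disj: "pairwise (\<lambda>z w. E z \<inter> E w = {}) Z" and p: "0 \<le> p" "p \<le> 1"
  shows "emeasure (bond_law p xi) {W \<in> space (bond_law p xi). \<forall>z\<in>Z. \<exists>e\<in>E z. W e}
    \<le> (\<Prod>z\<in>Z. of_nat (card (E z)) * ennreal p)"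
proof -
  let ?B = "bond_law p xi"
  let ?O = "\<lambda>S. {W \<in> space ?B. \<forall>e\<in>S. W e}"
  have fP: "finite (PiE Z E)"
    using Z E by (intro finite_PiE) auto
  have sub: "f ` Z \<subseteq> DT_edges xi" if "f \<in> PiE Z E" for f
    using that E by blast
  have meas: "?O (f ` Z) \<in> sets ?B" if "f \<in> PiE Z E" for f
    using Z sub[OF that] by (intro sets.sets_Collect_finite_All sets_bond_law_open) auto
  have "{W \<in> space ?B. \<forall>z\<in>Z. \<exists>e\<in>E z. W e} \<subseteq> (\<Union>f\<in>PiE Z E. ?O (f ` Z))"
  proof safe
    fix W assume W: "W \<in> space ?B" "\<forall>z\<in>Z. \<exists>e\<in>E z. W e"
    then obtain f where f: "\<forall>z\<in>Z. f z \<in> E z \<and> W (f z)"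
      by metis
    then have "restrict f Z \<in> PiE Z E" by auto
    with W f show "W \<in> (\<Union>f\<in>PiE Z E. ?O (f ` Z))"
      by (intro UN_I[of "restrict f Z"]) auto
  qed
  then have "emeasure ?B {W \<in> space ?B. \<forall>z\<in>Z. \<exists>e\<in>E z. W e} \<le> emeasure ?B (\<Union>f\<in>PiE Z E. ?O (f ` Z))"
    using meas fP by (intro emeasure_mono sets.finite_UN) auto
  also have "\<dots> \<le> (\<Sum>f\<in>PiE Z E. emeasure ?B (?O (f ` Z)))"
    using meas fP by (intro emeasure_subadditive_finite) auto
  also have "\<dots> = (\<Sum>f\<in>PiE Z E. ennreal p ^ card Z)"
  proof (rule sum.cong[OF refl])
    fix f assume f: "f \<in> PiE Z E"
    have "inj_on f Z"
      using f disj by (auto simp: inj_on_def pairwise_def PiE_iff) (metis disjoint_iff)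
    then show "emeasure ?B (?O (f ` Z)) = ennreal p ^ card Z"
      using emeasure_bond_law_all_open[OF sub[OF f] _ p] Z by (simp add: card_image)
  qed
  also have "\<dots> = (\<Prod>z\<in>Z. of_nat (card (E z)) * ennreal p)"
    using Z by (simp add: card_PiE prod.distrib)
  finally show ?thesis .
qed

text \<open>Only the sites outside \<open>bad_conf\<close> constrain the bonds, each at cost at most
  M^2 p. A site in \<open>bad_conf\<close> contributes a factor at least 1, so the bound becomes a
  product over all of \<open>Z\<close>, ready for integration over the configuration.\<close>

lemma emeasure_bond_law_bad_sites:
  fixes Z :: "'a::euclidean_space set" and M :: nat
  assumes r: "r > 0" and xi: "xi \<in> Nset" and Z: "finite Z"
    and sep: "pairwise (\<lambda>z w. 19 * real DIM('a) \<le> dist z w) Z" and p: "0 \<le> p" "p \<le> 1"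
  defines "U \<equiv> {W \<in> space (bond_law p xi). \<forall>z\<in>Z. xi \<in> bad_conf r M z \<or> (\<exists>e\<in>near_edges r xi z. W e)}"
  shows "U \<in> sets (bond_law p xi)"
    and "emeasure (bond_law p xi) U \<le> (\<Prod>z\<in>Z. indicator (bad_conf r M z) xi + ennreal (real (M\<^sup>2) * p))"
proof -
  define Y where "Y = {z \<in> Z. xi \<notin> bad_conf r M z}"
  have Y: "finite Y" using Z by (simp add: Y_def)
  have U: "U = {W \<in> space (bond_law p xi). \<forall>z\<in>Y. \<exists>e\<in>near_edges r xi z. W e}"
    by (auto simp: U_def Y_def)
  have near: "near_edges r xi z \<subseteq> DT_edges xi" for z
    by (auto simp: near_edges_def)
  show "U \<in> sets (bond_law p xi)"
    unfolding U using Y near finite_near_edges(1)[OF xi]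
    by (intro sets.sets_Collect_finite_All sets.sets_Collect_finite_Ex sets_bond_law_open) auto
  have "emeasure (bond_law p xi) U \<le> (\<Prod>z\<in>Y. of_nat (card (near_edges r xi z)) * ennreal p)"
    unfolding U
  proof (rule emeasure_bond_law_each_some_open[OF Y _ _ p])
    show "pairwise (\<lambda>z w. near_edges r xi z \<inter> near_edges r xi w = {}) Y"
      using sep near_edges_disjoint[OF r, of _ _ xi] by (auto simp: pairwise_def Y_def)
  qed (use near finite_near_edges(1)[OF xi] in auto)
  also have "\<dots> \<le> (\<Prod>z\<in>Y. ennreal (real (M\<^sup>2) * p))"
  proof (rule prod_mono_ennreal)
    fix z assume "z \<in> Y"
    then have "card (near_edges r xi z) \<le> M\<^sup>2"
      using finite_near_edges(2)[OF xi] by (auto simp: Y_def)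
    then have "real (card (near_edges r xi z)) * p \<le> real (M\<^sup>2) * p"
      using p by (intro mult_right_mono) (auto simp del: of_nat_power)
    then have "ennreal (real (card (near_edges r xi z)) * p) \<le> ennreal (real (M\<^sup>2) * p)"
      by (rule ennreal_leI)
    then show "of_nat (card (near_edges r xi z)) * ennreal p \<le> ennreal (real (M\<^sup>2) * p)"
      using p by (simp only: ennreal_mult of_nat_0_le_iff ennreal_of_nat_eq_real_of_nat)
  qed
  also have "\<dots> = (\<Prod>z\<in>Z. if xi \<notin> bad_conf r M z then ennreal (real (M\<^sup>2) * p) else 1)"
    unfolding Y_def by (rule prod.inter_filter[OF Z])
  also have "\<dots> \<le> (\<Prod>z\<in>Z. indicator (bad_conf r M z) xi + ennreal (real (M\<^sup>2) * p))"
    by (intro prod_mono_ennreal) (auto simp: indicator_def)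
  finally show "emeasure (bond_law p xi) U \<le> \<dots>" .
qed

section \<open>Finite range of dependence\<close>

lemma space_Nspace: "space Nspace = Nset"
  unfolding Nspace_def by (rule space_measure_of) auto

lemma Nset_Int:
  assumes "xi \<in> Nset"
  shows "xi \<inter> B \<in> Nset"
  unfolding Nset_def
proof (intro CollectI allI impI)
  fix K :: "'a set" assume "bounded K"
  then have "finite (xi \<inter> K)"
    using assms by (simp add: Nset_def)
  then show "finite (xi \<inter> B \<inter> K)"
    by (rule rev_finite_subset) auto
qed

lemma ncount_Int: "A \<subseteq> B \<Longrightarrow> ncount (xi \<inter> B) A = ncount xi A"
  by (simp add: ncount_def Int_assoc Int_absorb1)

lemma sets_ncount:
  assumes "A \<in> sets borel"
  shows "{xi \<in> Nset. ncount xi A \<in> K} \<in> sets Nspace"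
proof -
  have "{xi \<in> Nset. ncount xi A = k} \<in> sets Nspace" for k
    using assms unfolding Nspace_def by (intro in_measure_of) auto
  then have "(\<Union>k\<in>K. {xi \<in> Nset. ncount xi A = k}) \<in> sets Nspace"
    by (intro sets.countable_UN') auto
  also have "(\<Union>k\<in>K. {xi \<in> Nset. ncount xi A = k}) = {xi \<in> Nset. ncount xi A \<in> K}"
    by auto
  finally show ?thesis .
qed

text \<open>Membership in a set of counts is the common form that lets the general facts about
  \<open>ncount\<close> apply to voids and crowding alike.\<close>

abbreviation void_conf :: "'a::euclidean_space \<Rightarrow> real \<Rightarrow> 'a set set" where
  "void_conf a \<rho> \<equiv> {xi \<in> Nset. ncount xi (cball a \<rho>) \<in> {0}}"

abbreviation crowded_conf :: "nat \<Rightarrow> 'a::euclidean_space \<Rightarrow> real \<Rightarrow> 'a set set" where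
  "crowded_conf M a \<rho> \<equiv> {xi \<in> Nset. ncount xi (cball a \<rho>) \<in> {enat M<..}}"

lemma bad_conf_eq:
  "bad_conf r M (z::'a::euclidean_space) =
    (\<Union>u \<in> int_lattice \<inter> cball 0 (7 * real DIM('a)). void_conf (r *\<^sub>R (z + u)) (r * DIM('a))) \<union>
    crowded_conf M (r *\<^sub>R z) (9 * (r * DIM('a)))"
  by (auto simp: bad_conf_def)

lemma sets_bad_conf: "bad_conf r M z \<in> sets Nspace"
  unfolding bad_conf_eq
  by (intro sets.Un sets.finite_UN finite_int_lattice_cball sets_ncount) auto

section \<open>Local events and their independence\<close>

definition independent_at_distance :: "real \<Rightarrow> 'a::euclidean_space set measure \<Rightarrow> bool" where
  "independent_at_distance L P \<longleftrightarrow>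
     (\<forall>A B. A \<in> sets borel \<longrightarrow> B \<in> sets borel \<longrightarrow> (\<forall>a\<in>A. \<forall>b\<in>B. L \<le> dist a b) \<longrightarrow>
        prob_space.indep_set P (restr_events P A) (restr_events P B))"

text \<open>That \<open>S\<close> is decided inside \<open>B\<close> is stated as invariance under
  restriction to \<open>B\<close>; thus \<open>S\<close> serves as its own witness in
  \<open>restr_events\<close>.\<close>

definition local_event :: "'a::euclidean_space set \<Rightarrow> 'a set set \<Rightarrow> bool" where
  "local_event B S \<longleftrightarrow> S \<in> sets Nspace \<and> (\<forall>xi\<in>Nset. xi \<inter> B \<in> S \<longleftrightarrow> xi \<in> S)"

lemma local_event_restr_events:
  assumes "local_event B S" "sets P = sets Nspace"
  shows "S \<in> restr_events P B"
proof -
  have "S \<subseteq> Nset"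
    using assms sets.sets_into_space[of S Nspace] by (simp add: local_event_def space_Nspace)
  moreover have "space P = Nset"
    using sets_eq_imp_space_eq[OF assms(2)] by (simp add: space_Nspace)
  moreover have "xi \<inter> B \<in> S \<longleftrightarrow> xi \<in> S" if "xi \<in> Nset" for xi
    using assms(1) that by (simp add: local_event_def)
  ultimately have "S = (\<lambda>xi. xi \<inter> B) -` S \<inter> space P"
    by blast
  moreover have "S \<in> sets Nspace"
    using assms by (simp add: local_event_def)
  ultimately show ?thesis
    unfolding restr_events_def by blast
qed

lemma local_event_mono:
  assumes "local_event B S" "B \<subseteq> B'"
  shows "local_event B' S"
proof -
  have "xi \<inter> B' \<in> S \<longleftrightarrow> xi \<in> S" if "xi \<in> Nset" for xi
  proof -
    have "xi \<inter> B' \<in> S \<longleftrightarrow> xi \<inter> B' \<inter> B \<in> S"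
      using assms(1) Nset_Int[OF that] by (simp add: local_event_def)
    also have "xi \<inter> B' \<inter> B = xi \<inter> B"
      using assms(2) by auto
    finally show ?thesis
      using assms(1) that by (simp add: local_event_def)
  qed
  then show ?thesis
    using assms(1) by (simp add: local_event_def)
qed

lemma local_event_all:
  assumes "finite I" "\<And>i. i \<in> I \<Longrightarrow> local_event B (S i)"
  shows "local_event B {xi \<in> Nset. \<forall>i\<in>I. xi \<in> S i}"
proof -
  have "{xi \<in> space Nspace. \<forall>i\<in>I. xi \<in> S i} \<in> sets Nspace"
  proof (rule sets.sets_Collect_finite_All)
    fix i assume "i \<in> I"
    then have "S i \<in> sets Nspace" using assms by (auto simp: local_event_def)
    then show "{xi \<in> space Nspace. xi \<in> S i} \<in> sets Nspace"
      by (metis Collect_conj_eq Collect_mem_eq sets.Int_space_eq1)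
  qed fact
  then show ?thesis
    using assms by (auto simp: local_event_def space_Nspace Nset_Int)
qed

lemma local_event_ncount:
  assumes "A \<in> sets borel"
  shows "local_event A {xi \<in> Nset. ncount xi A \<in> K}"
  using sets_ncount[OF assms, of K] by (simp add: local_event_def Nset_Int ncount_Int)

text \<open>A void ball of radius h with centre within 7h of the site lies inside the ball of radius
  9h used for crowding.\<close>

lemma local_event_bad_conf:
  fixes z :: "'a::euclidean_space"
  assumes "r > 0"
  shows "local_event (cball (r *\<^sub>R z) (9 * (r * DIM('a)))) (bad_conf r M z)"
proof -
  have "cball (r *\<^sub>R (z + u)) (r * DIM('a)) \<subseteq> cball (r *\<^sub>R z) (9 * (r * DIM('a)))"
    if "norm u \<le> 7 * real DIM('a)" for u :: 'a
  proof -
    have "r * norm u \<le> r * (7 * real DIM('a))"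
      using that assms by simp
    moreover have "0 < r * DIM('a)" using assms by simp
    ultimately have "dist (r *\<^sub>R (z + u)) (r *\<^sub>R z) + r * DIM('a) \<le> 9 * (r * DIM('a))"
      using assms by (simp add: dist_norm scaleR_add_right)
    then show ?thesis
      by (subst cball_subset_cball_iff) auto
  qed
  then have *: "ncount (xi \<inter> cball (r *\<^sub>R z) (9 * (r * DIM('a)))) (cball (r *\<^sub>R (z + u)) (r * DIM('a)))
      = ncount xi (cball (r *\<^sub>R (z + u)) (r * DIM('a)))"
    if "norm u \<le> 7 * real DIM('a)" for u xi
    using that ncount_Int by metis
  have "xi \<inter> cball (r *\<^sub>R z) (9 * (r * DIM('a))) \<in> bad_conf r M z \<longleftrightarrow> xi \<in> bad_conf r M z"
    if "xi \<in> Nset" for xi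
    using that * by (simp add: bad_conf_def Nset_Int ncount_Int)
  then show ?thesis
    by (simp add: local_event_def sets_bad_conf)
qed

text \<open>Independence of two regions extends to finitely many by induction: the earlier events
  together are local to the union of their balls, and after removing both radii this union still has
  distance at least L from the new ball.\<close>

lemma prob_separated_local_events:
  fixes c :: "'i \<Rightarrow> 'a::euclidean_space"
  assumes P: "prob_space P" "sets P = sets Nspace"
    and dep: "independent_at_distance L P"
    and "finite I" "\<And>i. i \<in> I \<Longrightarrow> local_event (cball (c i) \<rho>) (S i)"
    and "pairwise (\<lambda>i j. 2 * \<rho> + L \<le> dist (c i) (c j)) I"
  shows "measure P {xi \<in> Nset. \<forall>i\<in>I. xi \<in> S i} = (\<Prod>i\<in>I. measure P (S i))"
  using assms(4-)
proof (induction I rule: finite_induct)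
  case empty
  have "space P = Nset"
    using sets_eq_imp_space_eq[OF P(2)] by (simp add: space_Nspace)
  then show ?case
    using prob_space.prob_space[OF P(1)] by simp
next
  case (insert i I)
  let ?B = "\<Union>j\<in>I. cball (c j) \<rho>"
  have "local_event ?B {xi \<in> Nset. \<forall>i\<in>I. xi \<in> S i}"
    using insert by (intro local_event_all local_event_mono[of "cball (c _) \<rho>" "S _" ?B]) auto
  then have I: "{xi \<in> Nset. \<forall>i\<in>I. xi \<in> S i} \<in> restr_events P ?B"
    by (rule local_event_restr_events) fact
  have i: "S i \<in> restr_events P (cball (c i) \<rho>)"
    using insert P(2) by (intro local_event_restr_events) auto
  have "L \<le> dist a b" if "j \<in> I" "a \<in> cball (c i) \<rho>" "b \<in> cball (c j) \<rho>" for j a b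
  proof -
    have "2 * \<rho> + L \<le> dist (c i) (c j)"
      using insert that by (auto simp: pairwise_insert)
    then show ?thesis
      using that dist_triangle[of "c i" "c j" a] dist_triangle[of a "c j" b]
      by (simp add: dist_commute)
  qed
  then have "prob_space.indep_set P (restr_events P (cball (c i) \<rho>)) (restr_events P ?B)"
    using insert by (intro dep[unfolded independent_at_distance_def, rule_format] sets.finite_UN) auto
  from prob_space.indep_setD[OF P(1) this i I]
  have "measure P (S i \<inter> {xi \<in> Nset. \<forall>i\<in>I. xi \<in> S i}) = (\<Prod>i\<in>insert i I. measure P (S i))"
    using insert by (simp add: pairwise_insert)
  moreover have "S i \<subseteq> Nset"
    using insert sets.sets_into_space[of "S i" Nspace] by (simp add: local_event_def space_Nspace)
  then have "S i \<inter> {xi \<in> Nset. \<forall>i\<in>I. xi \<in> S i} = {xi \<in> Nset. \<forall>i\<in>insert i I. xi \<in> S i}"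
    by auto
  ultimately show ?case by simp
qed

text \<open>Expand the product over subsets of \<open>Z\<close>, factor each term by independence,
  and fold the expansion back.\<close>

lemma nn_integral_prod_indicator_add:
  fixes c :: ennreal
  assumes Z: "finite Z" and A: "\<And>z. z \<in> Z \<Longrightarrow> A z \<in> sets M"
    and indep: "\<And>X. X \<subseteq> Z \<Longrightarrow> emeasure M {x \<in> space M. \<forall>z\<in>X. x \<in> A z} = (\<Prod>z\<in>X. emeasure M (A z))"
  shows "(\<integral>\<^sup>+x. (\<Prod>z\<in>Z. indicator (A z) x + c) \<partial>M) = (\<Prod>z\<in>Z. emeasure M (A z) + c)"
proof -
  let ?E = "\<lambda>X. {x \<in> space M. \<forall>z\<in>X. x \<in> A z}"
  have E: "?E X \<in> sets M" if "X \<in> Pow Z" for X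
  proof (rule sets.sets_Collect_finite_All)
    fix z assume "z \<in> X"
    then have "A z \<in> sets M" using that A by auto
    then show "{x \<in> space M. x \<in> A z} \<in> sets M"
      by (metis Collect_conj_eq Collect_mem_eq sets.Int_space_eq1)
  qed (use that Z finite_subset in auto)
  have ind: "(\<Prod>z\<in>X. indicator (A z) x) = (indicator (?E X) x :: ennreal)"
    if "x \<in> space M" "X \<in> Pow Z" for x X
  proof -
    have "finite X" using that Z finite_subset by auto
    then show ?thesis
      using that(1) by (induction rule: finite_induct) (auto simp: indicator_def)
  qed
  have "(\<integral>\<^sup>+x. (\<Prod>z\<in>Z. indicator (A z) x + c) \<partial>M)
      = (\<integral>\<^sup>+x. (\<Sum>X\<in>Pow Z. indicator (?E X) x * c ^ card (Z - X)) \<partial>M)"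
    by (intro nn_integral_cong) (simp add: prod_add[OF Z] ind)
  also have "\<dots> = (\<Sum>X\<in>Pow Z. (\<integral>\<^sup>+x. indicator (?E X) x * c ^ card (Z - X) \<partial>M))"
    using E by (intro nn_integral_sum borel_measurable_times_ennreal borel_measurable_indicator) auto
  also have "\<dots> = (\<Sum>X\<in>Pow Z. (\<Prod>z\<in>X. emeasure M (A z)) * c ^ card (Z - X))"
    using E indep by (intro sum.cong refl) (simp add: nn_integral_multc)
  also have "\<dots> = (\<Prod>z\<in>Z. emeasure M (A z) + c)"
    by (simp add: prod_add[OF Z])
  finally show ?thesis .
qed

section \<open>Stationarity and the probability of a bad site\<close>

lemma shift_Nset:
  assumes "xi \<in> Nset"
  shows "shift a xi \<in> Nset"
  unfolding Nset_def
proof (intro CollectI allI impI)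
  fix K :: "'a set" assume "bounded K"
  then have "finite (xi \<inter> (\<lambda>z. a + z) ` K)"
    using assms bounded_translation by (auto simp: Nset_def)
  moreover have "shift a xi \<inter> K \<subseteq> (\<lambda>z. z - a) ` (xi \<inter> (\<lambda>z. a + z) ` K)"
    by (force simp: shift_def)
  ultimately show "finite (shift a xi \<inter> K)"
    by (meson finite_imageI finite_subset)
qed

lemma ncount_shift: "ncount (shift a xi) (cball 0 \<rho>) = ncount xi (cball a \<rho>)"
proof -
  have *: "shift a xi \<inter> cball 0 \<rho> = (\<lambda>z. z - a) ` (xi \<inter> cball a \<rho>)"
    by (auto simp: shift_def dist_norm norm_minus_commute)
  have "inj_on (\<lambda>z. z - a) (xi \<inter> cball a \<rho>)"
    by (auto simp: inj_on_def)
  then show ?thesis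
    unfolding ncount_def * by (simp add: finite_image_iff card_image)
qed

lemma stationary_ncount:
  fixes P :: "'a::euclidean_space set measure"
  assumes "stationary P" "sets P = sets Nspace"
  shows "measure P {xi \<in> Nset. ncount xi (cball a \<rho>) \<in> K} = measure P {xi \<in> Nset. ncount xi (cball 0 \<rho>) \<in> K}"
proof -
  have shift: "shift a ` {xi \<in> Nset. ncount xi (cball a \<rho>) \<in> K} = {xi \<in> Nset. ncount xi (cball 0 \<rho>) \<in> K}"
  proof (intro equalityI subsetI)
    \<comment> \<open>Stationarity concerns direct images of events, so the image has to be
      identified exactly; shifting back by \<open>- a\<close> supplies preimages.\<close>
    fix xi :: "'a set" assume xi: "xi \<in> {xi \<in> Nset. ncount xi (cball 0 \<rho>) \<in> K}"
    have eq: "shift a (shift (- a) xi) = xi"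
      by (force simp: shift_def)
    then have "shift (- a) xi \<in> {xi \<in> Nset. ncount xi (cball a \<rho>) \<in> K}"
      using xi shift_Nset ncount_shift[of a "shift (- a) xi" \<rho>] by auto
    then show "xi \<in> shift a ` {xi \<in> Nset. ncount xi (cball a \<rho>) \<in> K}"
      by (intro image_eqI[of _ _ "shift (- a) xi"]) (simp_all only: eq)
  qed (auto simp: shift_Nset ncount_shift)
  have "{xi \<in> Nset. ncount xi (cball a \<rho>) \<in> K} \<in> sets P"
    using sets_ncount[of "cball a \<rho>" K] assms(2) by simp
  then have "emeasure P (shift a ` {xi \<in> Nset. ncount xi (cball a \<rho>) \<in> K})
      = emeasure P {xi \<in> Nset. ncount xi (cball a \<rho>) \<in> K}"
    using assms(1) unfolding stationary_def by blast
  then show ?thesis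
    unfolding shift by (simp add: measure_def)
qed

text \<open>A void ball and a distant translate of it are independent, so that the probability of the
  empty configuration is at most its own square.\<close>
lemma void_conf_tendsto_0:
  fixes P :: "'a::euclidean_space set measure"
  assumes P: "prob_space P" "sets P = sets Nspace" "stationary P"
    and L: "L > 0" and dep: "independent_at_distance L P"
    and ne: "measure P {{}} \<noteq> 1"
  shows "(\<lambda>n. measure P (void_conf 0 (real n))) \<longlonglongrightarrow> 0"
proof -
  interpret prob_space P by fact
  have ev: "void_conf a \<rho> \<in> events" for a \<rho>
    using sets_ncount[of "cball a \<rho>" "{0}"] P(2) by auto
  have empty: "{} \<in> void_conf a \<rho>" for a :: 'a and \<rho>
    by (auto simp: Nset_def ncount_eq_0_iff)
  have "(\<Inter>n. void_conf (0::'a) (real n)) = {{}}"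
  proof (intro equalityI subsetI)
    fix xi :: "'a set" assume xi: "xi \<in> (\<Inter>n. void_conf 0 (real n))"
    have "x \<notin> xi" for x
    proof -
      obtain n where "norm x \<le> real n"
        using real_arch_simple by blast
      moreover have "xi \<inter> cball 0 (real n) = {}"
        using xi by (auto simp: ncount_eq_0_iff)
      ultimately show ?thesis
        by auto
    qed
    then show "xi \<in> {{}}" by auto
  next
    fix xi :: "'a set" assume "xi \<in> {{}}"
    then show "xi \<in> (\<Inter>n. void_conf 0 (real n))"
      using empty by blast
  qed
  moreover have "decseq (\<lambda>n. void_conf (0::'a) (real n))"
  proof (rule decseq_SucI, rule subsetI)
    fix n and xi :: "'a set" assume "xi \<in> void_conf 0 (real (Suc n))"
    moreover have "cball (0::'a) (real n) \<subseteq> cball 0 (real (Suc n))"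
      by (rule subset_cball) simp
    ultimately show "xi \<in> void_conf 0 (real n)"
      unfolding ncount_eq_0_iff mem_Collect_eq singleton_iff by blast
  qed
  ultimately have lim: "(\<lambda>n. measure P (void_conf 0 (real n))) \<longlonglongrightarrow> measure P {{}}"
    using finite_Lim_measure_decseq[of "\<lambda>n. void_conf 0 (real n)"] ev by auto
  have "prob {{}} \<le> prob (void_conf 0 (real n)) * prob (void_conf 0 (real n))" for n
  proof -
    obtain b :: 'a where b: "b \<in> Basis" using nonempty_Basis by blast
    \<comment> \<open>This distance leaves a gap of L between the two balls of radius n.\<close>
    define a where "a = (2 * real n + L) *\<^sub>R b"
    have a: "norm a = 2 * real n + L"
      using b L by (simp add: a_def)
    have "\<forall>x\<in>cball (0::'a) (real n). \<forall>y\<in>cball a (real n). L \<le> dist x y"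
    proof safe
      fix x y :: 'a assume "x \<in> cball 0 (real n)" "y \<in> cball a (real n)"
      then show "L \<le> dist x y"
        using a dist_triangle[of 0 a x] dist_triangle[of x a y] by (simp add: dist_commute)
    qed
    then have indep: "indep_set (restr_events P (cball 0 (real n))) (restr_events P (cball a (real n)))"
      by (intro dep[unfolded independent_at_distance_def, rule_format]) auto
    have re: "void_conf c (real n) \<in> restr_events P (cball c (real n))" for c
      by (rule local_event_restr_events[OF local_event_ncount P(2)]) simp
    have "prob (void_conf 0 (real n) \<inter> void_conf a (real n)) =
        prob (void_conf 0 (real n)) * prob (void_conf a (real n))"
      by (rule indep_setD[OF indep re re])
    moreover have "prob {{}} \<le> prob (void_conf 0 (real n) \<inter> void_conf a (real n))"
      by (intro finite_measure_mono sets.Int ev) (use empty in blast)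
    ultimately show ?thesis
      unfolding stationary_ncount[OF P(3,2), of a "real n" "{0}"] by simp
  qed
  \<comment> \<open>Both void probabilities tend to that of the empty configuration; a probability
    bounded by its own square is 0 or 1, and 1 is excluded.\<close>
  then have "prob {{}} \<le> prob {{}} * prob {{}}"
    using LIMSEQ_le_const[OF tendsto_mult[OF lim lim]] by blast
  then have "prob {{}} * (1 - prob {{}}) \<le> 0"
    by (simp add: algebra_simps)
  then have "prob {{}} = 0"
    using ne prob_le_1[of "{{}}"] measure_nonneg[of P "{{}}"] by (simp add: mult_le_0_iff)
  with lim show ?thesis by simp
qed

text \<open>By local finiteness the decreasing events have empty intersection: a configuration
  leaves them once M reaches its own count. Continuity from above concludes.\<close>

lemma crowded_conf_tendsto_0:
  fixes a :: "'a::euclidean_space"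
  assumes "prob_space P" "sets P = sets Nspace"
  shows "(\<lambda>M. measure P (crowded_conf M a \<rho>)) \<longlonglongrightarrow> 0"
proof -
  interpret prob_space P by fact
  have "(\<Inter>M. crowded_conf M a \<rho>) = {}"
  proof (rule equals0I)
    fix xi assume xi: "xi \<in> (\<Inter>M. crowded_conf M a \<rho>)"
    then have "finite (xi \<inter> cball a \<rho>)"
      by (auto simp: Nset_def)
    then have "ncount xi (cball a \<rho>) = enat (card (xi \<inter> cball a \<rho>))"
      by (simp add: ncount_def)
    moreover have "enat (card (xi \<inter> cball a \<rho>)) < ncount xi (cball a \<rho>)"
      using xi by simp
    ultimately show False by simp
  qed
  moreover have "decseq (\<lambda>M. crowded_conf M a \<rho>)"
  proof (rule decseq_SucI, rule subsetI)
    fix M xi assume "xi \<in> crowded_conf (Suc M) a \<rho>"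
    moreover have "enat M < enat (Suc M)" by simp
    ultimately show "xi \<in> crowded_conf M a \<rho>"
      by (auto elim: less_trans[rotated])
  qed
  moreover have "range (\<lambda>M. crowded_conf M a \<rho>) \<subseteq> events"
  proof (rule image_subsetI)
    show "crowded_conf M a \<rho> \<in> events" for M
      using sets_ncount[of "cball a \<rho>" "{enat M<..}"] assms(2) by simp
  qed
  ultimately show ?thesis
    using finite_Lim_measure_decseq[of "\<lambda>M. crowded_conf M a \<rho>"] by simp
qed

text \<open>Union bound; stationarity then moves every ball to the origin, which makes the estimate
  uniform in \<open>z\<close>.\<close>

lemma measure_bad_conf_le:
  fixes z :: "'a::euclidean_space"
  assumes P: "prob_space P" "sets P = sets Nspace" "stationary P"
  shows "measure P (bad_conf r M z) \<le>
    real (card (int_lattice \<inter> cball (0::'a) (7 * real DIM('a)))) * measure P (void_conf 0 (r * DIM('a)))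
    + measure P (crowded_conf M 0 (9 * (r * DIM('a))))"
proof -
  interpret prob_space P by fact
  let ?D = "int_lattice \<inter> cball (0::'a) (7 * real DIM('a))"
  let ?V = "\<Union>u \<in> ?D. void_conf (r *\<^sub>R (z + u)) (r * DIM('a))"
  have ev: "{xi \<in> Nset. ncount xi (cball a \<rho>) \<in> K} \<in> events" for a \<rho> K
    using sets_ncount[of "cball a \<rho>"] P(2) by simp
  have "prob (bad_conf r M z) \<le> prob ?V + prob (crowded_conf M (r *\<^sub>R z) (9 * (r * DIM('a))))"
    unfolding bad_conf_eq
    by (intro measure_Un_le sets.finite_UN finite_int_lattice_cball ev)
  also have "prob ?V \<le> (\<Sum>u\<in>?D. prob (void_conf (r *\<^sub>R (z + u)) (r * DIM('a))))"
    by (intro measure_UNION_le finite_int_lattice_cball ev)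
  also have "\<dots> = real (card ?D) * prob (void_conf 0 (r * DIM('a)))"
    by (subst stationary_ncount[OF P(3,2)]) simp
  also have "prob (crowded_conf M (r *\<^sub>R z) (9 * (r * DIM('a)))) = prob (crowded_conf M 0 (9 * (r * DIM('a))))"
    by (rule stationary_ncount[OF P(3,2)])
  finally show ?thesis
    by simp
qed

section \<open>The Peierls estimate\<close>

text \<open>The Peierls sum with mesh, crowding threshold and p as parameters: \<open>small\<close>
  says that the number of increments times the cost of a site is at most 1/2.\<close>

lemma AE_all_clusters_bounded:
  fixes P :: "'a::euclidean_space set measure" and r q p :: real and M :: nat
  assumes P: "prob_space P" "sets P = sets Nspace"
    and dep: "independent_at_distance L P"
    and r: "r > 0" "L \<le> r * DIM('a)"
    and q: "\<And>z. measure P (bad_conf r M z) \<le> q"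
    and p: "0 \<le> p" "p \<le> 1"
    and small: "real (card (int_lattice \<inter> cball (0::'a) (23 * real DIM('a)))) * (q + real (M\<^sup>2) * p) \<le> 1 / 2"
  shows "AE xi in P. xi \<in> Npol \<longrightarrow> (AE W in bond_law p xi. all_clusters_bounded xi W)"
proof -
  interpret prob_space P by fact
  define A where "A z = bad_conf r M z" for z :: 'a
  define c where "c = ennreal (real (M\<^sup>2) * p)"
  define t where "t = q + real (M\<^sup>2) * p"
  define N where "N = card (int_lattice \<inter> cball (0::'a) (23 * real DIM('a)))"
  define G where "G n z = sep_paths (19 * real DIM('a)) (23 * real DIM('a)) n z" for n and z :: 'a
  \<comment> \<open>A bound for the conditional probability, given \<open>xi\<close>, that some
    chain from \<open>z\<close> has every site in \<open>bad_conf\<close> or near an open edge.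
    Integrating this bound instead of that probability avoids the question whether the latter is
    measurable in \<open>xi\<close>.\<close>
  define g where "g n z xi = (\<Sum>\<gamma>\<in>G n z. \<Prod>v\<in>set \<gamma>. indicator (A v) xi + c)" for n z xi
  have A: "A z \<in> sets P" for z
    unfolding A_def P(2) by (rule sets_bad_conf)
  have space_P: "space P = Nset"
    using sets_eq_imp_space_eq[OF P(2)] by (simp add: space_Nspace)
  have "0 \<le> q"
    using q[of 0] measure_nonneg[of P] order_trans by blast
  then have "0 \<le> t"
    using p by (simp add: t_def)
  have "0 \<in> int_lattice \<inter> cball (0::'a) (23 * real DIM('a))"
    by (simp add: int_lattice_def)
  then have "N \<ge> 1"
    using finite_int_lattice_cball card_gt_0_iff unfolding N_def by (metis One_nat_def Suc_leI empty_iff)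
  have Nt: "real N * t \<le> 1 / 2"
    using small by (simp add: N_def t_def)
  have "1 * t \<le> real N * t"
    using \<open>N \<ge> 1\<close> \<open>0 \<le> t\<close> by (intro mult_right_mono) auto
  then have "t \<le> 1"
    using Nt by simp
  have dist_scale: "dist (r *\<^sub>R z) (r *\<^sub>R w) = r * dist z w" for z w :: 'a
    using r by (simp add: dist_norm flip: scaleR_diff_right)
  have sep: "pairwise (\<lambda>v w. 19 * real DIM('a) \<le> dist v w) (set \<gamma>)" if "\<gamma> \<in> G n z" for \<gamma> n z
    using sep_paths_pairwise that unfolding G_def by blast
  have indep: "measure P {xi \<in> Nset. \<forall>z\<in>X. xi \<in> A z} = (\<Prod>z\<in>X. measure P (A z))"
    if "finite X" "pairwise (\<lambda>v w. 19 * real DIM('a) \<le> dist v w) X" for X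
  proof (rule prob_separated_local_events[OF P dep])
    show "local_event (cball (r *\<^sub>R z) (9 * (r * DIM('a)))) (A z)" for z
      unfolding A_def by (rule local_event_bad_conf) fact
    \<comment> \<open>19 = 2 * 9 + 1: the balls of radius 9h leave a gap of h, which is at least
      L.\<close>
    show "pairwise (\<lambda>z w. 2 * (9 * (r * DIM('a))) + L \<le> dist (r *\<^sub>R z) (r *\<^sub>R w)) X"
    proof (rule pairwise_mono[OF that(2)])
      fix z w :: 'a assume "19 * real DIM('a) \<le> dist z w"
      then have "r * (19 * real DIM('a)) \<le> r * dist z w"
        using r by simp
      then show "2 * (9 * (r * DIM('a))) + L \<le> dist (r *\<^sub>R z) (r *\<^sub>R w)"
        using r unfolding dist_scale by linarith
    qed simp
  qed (use that in auto)
  have path_le: "(\<integral>\<^sup>+xi. (\<Prod>v\<in>set \<gamma>. indicator (A v) xi + c) \<partial>P) \<le> ennreal (t ^ Suc n)"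
    if \<gamma>: "\<gamma> \<in> G n z" for \<gamma> n z
  proof -
    have "(\<integral>\<^sup>+xi. (\<Prod>v\<in>set \<gamma>. indicator (A v) xi + c) \<partial>P) = (\<Prod>v\<in>set \<gamma>. emeasure P (A v) + c)"
    proof (rule nn_integral_prod_indicator_add)
      fix X assume X: "X \<subseteq> set \<gamma>"
      then have "finite X"
        by (rule finite_subset) simp
      moreover have "pairwise (\<lambda>v w. 19 * real DIM('a) \<le> dist v w) X"
        using sep[OF \<gamma>] X by (rule pairwise_subset)
      ultimately have "measure P {xi \<in> Nset. \<forall>z\<in>X. xi \<in> A z} = (\<Prod>z\<in>X. measure P (A z))"
        by (rule indep)
      then show "emeasure P {xi \<in> space P. \<forall>z\<in>X. xi \<in> A z} = (\<Prod>z\<in>X. emeasure P (A z))"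
        by (simp add: emeasure_eq_measure space_P prod_ennreal)
    qed (use A in auto)
    also have "\<dots> \<le> (\<Prod>v\<in>set \<gamma>. ennreal t)"
    proof (rule prod_mono_ennreal)
      fix v
      have "measure P (A v) + real (M\<^sup>2) * p \<le> t"
        using q[of v] by (simp add: A_def t_def)
      then show "emeasure P (A v) + c \<le> ennreal t"
        using p by (simp add: emeasure_eq_measure c_def ennreal_leI flip: ennreal_plus)
    qed
    also have "\<dots> = ennreal (t ^ card (set \<gamma>))"
      using \<open>0 \<le> t\<close> by (simp add: ennreal_power)
    also have "card (set \<gamma>) = Suc n"
      by (rule sep_paths_card_set[OF \<gamma>[unfolded G_def]]) simp
    finally show ?thesis .
  qed
  have g_meas: "g n z \<in> borel_measurable P" for n z
    unfolding g_def
    by (intro borel_measurable_sum borel_measurable_prod_ennreal borel_measurable_add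
        borel_measurable_indicator A borel_measurable_const)
  have g_le: "(\<integral>\<^sup>+xi. g n z xi \<partial>P) \<le> ennreal ((1 / 2) ^ n)" for n z
  proof -
    have "(\<integral>\<^sup>+xi. g n z xi \<partial>P) = (\<Sum>\<gamma>\<in>G n z. \<integral>\<^sup>+xi. (\<Prod>v\<in>set \<gamma>. indicator (A v) xi + c) \<partial>P)"
      unfolding g_def
      by (intro nn_integral_sum borel_measurable_prod_ennreal borel_measurable_add
          borel_measurable_indicator A borel_measurable_const)
    also have "\<dots> \<le> (\<Sum>\<gamma>\<in>G n z. ennreal (t ^ Suc n))"
      by (intro sum_mono path_le)
    also have "\<dots> = ennreal (real (card (G n z)) * t ^ Suc n)"
      using \<open>0 \<le> t\<close> by (simp add: ennreal_mult ennreal_of_nat_eq_real_of_nat del: power_Suc)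
    also have "real (card (G n z)) * t ^ Suc n \<le> real N ^ n * t ^ Suc n"
    proof (rule mult_right_mono)
      have "card (G n z) \<le> N ^ n"
        unfolding G_def N_def by (rule card_sep_paths)
      then show "real (card (G n z)) \<le> real N ^ n"
        by (simp flip: of_nat_power)
    qed (use \<open>0 \<le> t\<close> in simp)
    \<comment> \<open>There are n steps but n + 1 sites; the spare factor \<open>t\<close> is at
      most 1.\<close>
    also have "\<dots> = (real N * t) ^ n * t"
      by (simp add: power_mult_distrib)
    also have "\<dots> \<le> (1 / 2) ^ n * 1"
      using Nt \<open>0 \<le> t\<close> \<open>t \<le> 1\<close> by (intro mult_mono power_mono) auto
    finally show ?thesis
      by (simp add: ennreal_leI)
  qed
  \<comment> \<open>The integral of the infimum is below each power of 1/2, so it vanishes.\<close>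
  have "AE xi in P. (INF n. g n z xi) = 0" for z
  proof -
    have "(\<integral>\<^sup>+xi. (INF n. g n z xi) \<partial>P) \<le> ennreal ((1 / 2) ^ n)" for n
    proof -
      have "(\<integral>\<^sup>+xi. (INF n. g n z xi) \<partial>P) \<le> (\<integral>\<^sup>+xi. g n z xi \<partial>P)"
        by (intro nn_integral_mono INF_lower) simp
      then show ?thesis
        using g_le order_trans by blast
    qed
    moreover have "(\<lambda>n. ennreal ((1 / 2) ^ n)) \<longlonglongrightarrow> ennreal 0"
      by (intro tendsto_ennrealI LIMSEQ_realpow_zero) auto
    ultimately have "(\<integral>\<^sup>+xi. (INF n. g n z xi) \<partial>P) \<le> ennreal 0"
      by (intro LIMSEQ_le_const) auto
    then show ?thesis
      using g_meas by (subst (asm) ennreal_0) (simp add: nn_integral_0_iff_AE)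
  qed
  then have "AE xi in P. \<forall>z\<in>int_lattice. (INF n. g n z xi) = 0"
    by (intro AE_ball_countable' countable_int_lattice)
  then show ?thesis
  proof (eventually_elim, intro impI)
    fix xi assume g0: "\<forall>z\<in>int_lattice. (INF n. g n z xi) = 0" and Npol: "xi \<in> Npol"
    then have xi: "xi \<in> Nset" by (simp add: Npol_def)
    let ?B = "bond_law p xi"
    define bad where "bad \<gamma> = {W \<in> space ?B. \<forall>z\<in>set \<gamma>. xi \<in> bad_conf r M z \<or> (\<exists>e\<in>near_edges r xi z. W e)}"
      for \<gamma>
    \<comment> \<open>Chains of every length from \<open>z\<close>. An unbounded cluster puts
      \<open>W\<close> into such a set for one of countably many \<open>z\<close>, so it is enough
      that each is null.\<close>
    define U where "U z = (\<Inter>n. \<Union>\<gamma>\<in>G n z. bad \<gamma>)" for z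
    have finG: "finite (G n z)" for n z
      unfolding G_def by (rule finite_sep_paths)
    have bad: "bad \<gamma> \<in> sets ?B" "emeasure ?B (bad \<gamma>) \<le> (\<Prod>v\<in>set \<gamma>. indicator (A v) xi + c)"
      if "\<gamma> \<in> G n z" for \<gamma> n z
      using emeasure_bond_law_bad_sites[OF r(1) xi _ sep[OF that] p, of M]
      by (simp_all add: bad_def A_def c_def)
    have bads: "(\<Union>\<gamma>\<in>G n z. bad \<gamma>) \<in> sets ?B" for n z
      by (intro sets.finite_UN finG bad(1))
    have "U z \<in> null_sets ?B" if z: "z \<in> int_lattice" for z
    proof (rule null_setsI)
      show U: "U z \<in> sets ?B"
        unfolding U_def using bads by (intro sets.countable_INT) auto
      have "emeasure ?B (U z) \<le> g n z xi" for n
      proof -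
        have "emeasure ?B (U z) \<le> emeasure ?B (\<Union>\<gamma>\<in>G n z. bad \<gamma>)"
          by (intro emeasure_mono bads) (auto simp: U_def)
        also have "\<dots> \<le> (\<Sum>\<gamma>\<in>G n z. emeasure ?B (bad \<gamma>))"
          using finG bad by (intro emeasure_subadditive_finite) auto
        also have "\<dots> \<le> g n z xi"
          unfolding g_def by (intro sum_mono bad(2))
        finally show ?thesis .
      qed
      then have "emeasure ?B (U z) \<le> (INF n. g n z xi)"
        by (intro INF_greatest) auto
      then show "emeasure ?B (U z) = 0"
        using g0 z by simp
    qed
    then have "AE W in ?B. \<forall>z\<in>int_lattice. W \<notin> U z"
      by (intro AE_ball_countable' countable_int_lattice AE_not_in)
    with AE_space show "AE W in ?B. all_clusters_bounded xi W"
    proof eventually_elim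
      fix W assume W: "W \<in> space ?B" "\<forall>z\<in>int_lattice. W \<notin> U z"
      show "all_clusters_bounded xi W"
        unfolding all_clusters_bounded_def
      proof (intro ballI, rule ccontr)
        fix x assume unb: "\<not> bounded (cluster xi W x)"
        have "\<exists>\<gamma>\<in>G n (lround r x). W \<in> bad \<gamma>" for n
          using unbounded_cluster_sep_path[OF r(1) Npol unb, of n M] W(1)
          by (simp add: G_def bad_def)
        then have "W \<in> U (lround r x)"
          by (simp add: U_def)
        then show False
          using W(2) lround_in_int_lattice by blast
      qed
    qed
  qed
qed

theorem theorem6p4:
  fixes P :: "'a::euclidean_space set measure"
  assumes "prob_space P"
    and "sets P = sets Nspace"
    and "stationary P"
    and "finite_intensity P"
    and "finite_range_dependence P"
  shows "\<exists>pstar. 0 < pstar \<and> pstar < 1 \<and>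
    (\<forall>p. 0 \<le> p \<and> p \<le> pstar \<longrightarrow>
      (AE xi in P. xi \<in> Npol \<longrightarrow> (AE W in bond_law p xi. all_clusters_bounded xi W)))"
proof (cases "measure P {{}} = 1")
  \<comment> \<open>Almost surely there are no vertices, so every p works and 1/2 is an arbitrary
    choice.\<close>
  case True
  interpret prob_space P by fact
  have "AE xi in P. xi \<in> {{}}"
    using True AE_prob_1 by blast
  then have "AE xi in P. xi \<in> Npol \<longrightarrow> (AE W in bond_law p xi. all_clusters_bounded xi W)" for p
    by (rule AE_mp) (auto simp: all_clusters_bounded_def intro!: AE_I2)
  then show ?thesis
    by (intro exI[of _ "1 / 2"]) auto
next
  case False
  obtain L where L: "L > 0" and dep: "independent_at_distance L P"
    using assms(5) unfolding finite_range_dependence_def independent_at_distance_def by blast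
  \<comment> \<open>Adding 1 makes \<open>N\<close> and \<open>D\<close> positive without any
    information on the cardinalities.\<close>
  define N where "N = real (card (int_lattice \<inter> cball (0::'a) (23 * real DIM('a)))) + 1"
  define D where "D = real (card (int_lattice \<inter> cball (0::'a) (7 * real DIM('a)))) + 1"
  have N: "N \<ge> 1" and D: "D \<ge> 1" by (simp_all add: N_def D_def)
  \<comment> \<open>The mesh is chosen first, because voids do not involve M; then M for this mesh,
    then p. Voids and crowding may each cost 1/(8N), which makes \<open>q\<close> equal to
    1/(4N).\<close>
  have "\<forall>\<^sub>F n in sequentially. measure P (void_conf 0 (real n)) < 1 / (8 * N * D)"
    by (rule order_tendstoD(2)[OF void_conf_tendsto_0[OF assms(1-3) L dep False]]) (use N D in auto)
  moreover have "\<forall>\<^sub>F n in sequentially. max L 1 \<le> real n"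
    by (rule filterlim_real_sequentially[unfolded filterlim_at_top, rule_format])
  ultimately have "\<forall>\<^sub>F n in sequentially. measure P (void_conf 0 (real n)) < 1 / (8 * N * D) \<and> max L 1 \<le> real n"
    by (rule eventually_conj)
  from eventually_happens'[OF sequentially_bot this] obtain n where n: "measure P (void_conf 0 (real n)) < 1 / (8 * N * D)" "max L 1 \<le> real n"
    by blast
  define r where "r = real n / DIM('a)"
  have r: "r > 0" "r * DIM('a) = real n"
    using n by (simp_all add: r_def)
  have "\<forall>\<^sub>F M in sequentially. measure P (crowded_conf M (0::'a) (9 * (r * DIM('a)))) < 1 / (8 * N)"
    by (rule order_tendstoD(2)[OF crowded_conf_tendsto_0[OF assms(1,2)]]) (use N in auto)
  then have "\<forall>\<^sub>F M in sequentially. measure P (crowded_conf M (0::'a) (9 * (r * DIM('a)))) < 1 / (8 * N) \<and> 1 \<le> M"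
    using eventually_ge_at_top by (rule eventually_conj)
  from eventually_happens'[OF sequentially_bot this] obtain M where M: "measure P (crowded_conf M (0::'a) (9 * (r * DIM('a)))) < 1 / (8 * N)" "1 \<le> M"
    by blast
  define q where "q = 1 / (4 * N)"
  have q: "measure P (bad_conf r M z) \<le> q" for z
  proof -
    have "(D - 1) * measure P (void_conf 0 (r * DIM('a))) \<le> D * (1 / (8 * N * D))"
      using n(1) D unfolding r(2) by (intro mult_mono) auto
    also have "\<dots> = 1 / (8 * N)"
      using D by simp
    finally have "(D - 1) * measure P (void_conf 0 (r * DIM('a))) \<le> 1 / (8 * N)" .
    moreover have "1 / (8 * N) + 1 / (8 * N) = q"
      by (simp add: q_def)
    ultimately show ?thesis
      using measure_bad_conf_le[OF assms(1-3), of r M z] M(1) unfolding D_def add_diff_cancel_right' by linarith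
  qed
  define k where "k = real (M\<^sup>2)"
  \<comment> \<open>Then M^2 p is at most q, and N (q + q) is exactly 1/2.\<close>
  define pstar where "pstar = q / k"
  have k: "1 \<le> k"
    using M(2) by (simp add: k_def)
  have q01: "0 < q" "q < 1"
    using N by (simp_all add: q_def)
  have pstar: "0 < pstar" "pstar < 1"
    using q01 k by (simp_all add: pstar_def divide_simps)
  have "AE xi in P. xi \<in> Npol \<longrightarrow> (AE W in bond_law p xi. all_clusters_bounded xi W)"
    if p: "0 \<le> p" "p \<le> pstar" for p
  proof (rule AE_all_clusters_bounded[OF assms(1,2) dep r(1) _ q])
    have "k * p \<le> k * pstar"
      using p k by (intro mult_left_mono) auto
    also have "k * pstar = q"
      using k by (simp add: pstar_def)
    finally have "q + k * p \<le> q + q" by simp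
    moreover have "0 \<le> q + k * p"
      using p k q01 by simp
    ultimately have "(N - 1) * (q + k * p) \<le> N * (q + q)"
      using N by (intro mult_mono) auto
    also have "\<dots> = 1 / 2"
      using N by (simp add: q_def)
    finally show "real (card (int_lattice \<inter> cball (0::'a) (23 * real DIM('a)))) * (q + real (M\<^sup>2) * p) \<le> 1 / 2"
      unfolding N_def k_def add_diff_cancel_right' .
    show "L \<le> r * DIM('a)"
      using n(2) unfolding r(2) by simp
    show "p \<le> 1"
      using p pstar by simp
  qed (fact p)
  with pstar show ?thesis by blast
qed

end
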